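(* Let $(\rho,\mathbf{u},\theta,\mathbf{B})$, with $\rho>0$ and $\theta>0$, be a sufficiently smooth solution in $\Omega\times(0,T)$ of the regularized magnetic gas dynamics (MGD) system of equations written in the context. Then the following internal energy balance equation holds: $$\partial_t(\rho\varepsilon)+\operatorname{div}[\rho\varepsilon(\mathbf{u}-\mathbf{w})]+p\operatorname{div}(\mathbf{u}-\mathbf{w})=\operatorname{div}[-\mathbf{q}+\tau(\mathbf{u}\cdot\mathbf{B})\boldsymbol\beta]+\Pi:\nabla\mathbf{u}+\mathbf{w}\cdot\nabla p$$ $$+\left[-\operatorname{div}(\mathbf{B}\otimes\mathbf{B})+\nabla\left(\tfrac12|\mathbf{B}|^2\right)-\rho\mathbf{F}\right]\cdot\widehat{\mathbf{w}}+\tau\left[(\mathbf{u}\cdot\nabla)\mathbf{B}\cdot\boldsymbol\beta-(\boldsymbol\beta\cdot\nabla)\mathbf{B}\cdot\mathbf{u}\right]+Q.$$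
   Context: **Setting and notation.** $\Omega$ is a domain in $\mathbb{R}^n$, $n\geqslant1$, and $(x,t)\in\Omega\times(0,T)$. The unknowns are the gas density $\rho>0$, velocity $\mathbf{u}=(u_1,\dots,u_n)$, absolute temperature $\theta>0$ and magnetic field $\mathbf{B}=(B_1,\dots,B_n)$. All functions are assumed smooth enough that all derivatives appearing exist and are continuous. $\operatorname{div}$ and $\nabla=(\partial_1,\dots,\partial_n)$ act in $x$; the divergence of a tensor is taken with respect to its first index, $(\operatorname{div}A)_j=\sum_i\partial_iA_{ij}$; $(\mathbf{a}\otimes\mathbf{b})_{ij}=a_ib_j$; $(A\mathbf{u})_i=\sum_jA_{ij}u_j$; $A:C=\sum_{i,j}A_{ij}C_{ij}$; $\nabla\mathbf{u}=\{\partial_iu_j\}_{i,j=1}^n$; $\mathbb{I}$ is the identity tensor of order $n$. **State equations.** The pressure $p=p(\rho,\theta)$ and the specific internal energy $\varepsilon=\varepsilon(\rho,\theta)$ are given functions satisfying the Maxwell relation $p=\theta p_\theta+\rho^2\varepsilon_\rho$ and the conditions $p_\rho\geqslant0$, $\varepsilon_\theta>0$ (subscripts $\rho,\theta$ denote partial derivatives of these state functions). The total non-magnetic energy is $E=\frac12\rho|\mathbf{u}|^2+\rho\varepsilon$. **Other data.** $\mathbf{F}=\mathbf{F}(x,t)$ is the given density of body forces, $Q=Q(x,t)\geqslant0$ the given power of heat sources, $\varkappa=\varkappa(\rho,\theta)\geqslant0$ the heat conductivity coefficient, and $\mu=\mu(\rho,\theta)\geqslant0$, $\lambda=\lambda(\rho,\theta)\geqslant0$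 the viscosity coefficients. The Navier–Stokes viscous stress tensor is $$\Pi_{NS}=\mu\left[2\mathbb{D}(\mathbf{u})-\tfrac23(\operatorname{div}\mathbf{u})\mathbb{I}\right]+\lambda(\operatorname{div}\mathbf{u})\mathbb{I},\qquad \mathbb{D}(\mathbf{u})=\tfrac12(\nabla\mathbf{u}+\nabla\mathbf{u}^T).$$ The relaxation parameter is a given function $\tau=\tau(\rho,\varepsilon,\mathbf{u},\mathbf{B})>0$. **Regularized MGD system.** $$\partial_t\rho+\operatorname{div}[\rho(\mathbf{u}-\mathbf{w})]=0,$$ $$\partial_t(\rho\mathbf{u})+\operatorname{div}[\rho(\mathbf{u}-\mathbf{w})\otimes\mathbf{u}-\mathbf{B}\otimes\mathbf{B}]+\nabla\left(p+\tfrac12|\mathbf{B}|^2\right)=\operatorname{div}\Pi+[\rho-\tau\operatorname{div}(\rho\mathbf{u})]\mathbf{F},$$ $$\partial_t\left(E+\tfrac12|\mathbf{B}|^2\right)+\operatorname{div}\left[(E+p)(\mathbf{u}-\mathbf{w})+|\mathbf{B}|^2(\mathbf{u}-\widehat{\mathbf{w}})-((\mathbf{u}-\widehat{\mathbf{w}})\cdot\mathbf{B})\mathbf{B}\right]=\operatorname{div}\left[-\mathbf{q}+\tau(\boldsymbol\beta\cdot\mathbf{B})\mathbf{u}+\Pi\mathbf{u}\right]+\rho(\mathbf{u}-\mathbf{w})\cdot\mathbf{F}+Q,$$ $$\partial_t\mathbf{B}+\operatorname{div}[(\mathbf{u}-\widehat{\mathbf{w}})\otimes\mathbf{B}-\mathbf{B}\otimes(\mathbf{u}-\widehat{\mathbf{w}})]=\operatorname{div}[\tau(\mathbf{u}\otimes\boldsymbol\beta-\boldsymbol\beta\otimes\mathbf{u})],\qquad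 \operatorname{div}\mathbf{B}=0,$$ where $$\mathbf{w}=\frac{\tau}{\rho}\left[\operatorname{div}(\rho\mathbf{u}\otimes\mathbf{u}-\mathbf{B}\otimes\mathbf{B})+\nabla\left(p+\tfrac12|\mathbf{B}|^2\right)-\rho\mathbf{F}\right],$$ $$\widehat{\mathbf{w}}=\frac{\tau}{\rho}\left[\rho(\mathbf{u}\cdot\nabla)\mathbf{u}-\operatorname{div}(\mathbf{B}\otimes\mathbf{B})+\nabla\left(p+\tfrac12|\mathbf{B}|^2\right)-\rho\mathbf{F}\right],$$ $$\Pi=\Pi_{NS}+\rho\mathbf{u}\otimes\widehat{\mathbf{w}}-\tau(\boldsymbol\beta\otimes\mathbf{B}+\mathbf{B}\otimes\boldsymbol\beta)+\tau\left(\mathbf{u}\cdot\nabla p+\rho C_s^2\operatorname{div}\mathbf{u}+\boldsymbol\beta\cdot\mathbf{B}-\frac{p_\theta}{\rho\varepsilon_\theta}Q\right)\mathbb{I},$$ $$C_s^2=p_\rho+\frac{\theta p_\theta^2}{\rho^2\varepsilon_\theta}\quad(C_s\geqslant0),$$ $$-\mathbf{q}=\varkappa\nabla\theta+\tau\left[\rho\left(\mathbf{u}\cdot\nabla\varepsilon-\frac{p}{\rho^2}\,\mathbf{u}\cdot\nabla\rho\right)-Q\right]\mathbf{u},\qquad \boldsymbol\beta=\operatorname{div}(\mathbf{u}\otimes\mathbf{B}-\mathbf{B}\otimes\mathbf{u}).$$ *)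

theory Defs
  imports "HOL-Analysis.Analysis"
begin

section \<open>Differential operators\<close>

text \<open>Fields take the position first and the time second.\<close>

type_synonym 'n scalar_field = "real^'n \<Rightarrow> real \<Rightarrow> real"
type_synonym 'n vector_field = "real^'n \<Rightarrow> real \<Rightarrow> real^'n"
type_synonym 'n tensor_field = "real^'n \<Rightarrow> real \<Rightarrow> real^'n^'n"

definition dx :: "'n::finite \<Rightarrow> 'n scalar_field \<Rightarrow> 'n scalar_field" where
  "dx i f x t = deriv (\<lambda>h. f (x + h *\<^sub>R axis i 1) t) 0"

definition dt :: "'n::finite scalar_field \<Rightarrow> 'n scalar_field" where
  "dt f x t = deriv (\<lambda>s. f x s) t"

definition dt_vec :: "'n::finite vector_field \<Rightarrow> 'n vector_field" where
  "dt_vec a x t = (\<chi> j. dt (\<lambda>x t. a x t $ j) x t)"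

definition grad :: "'n::finite scalar_field \<Rightarrow> 'n vector_field" where
  "grad f x t = (\<chi> i. dx i f x t)"

definition div_vec :: "'n::finite vector_field \<Rightarrow> 'n scalar_field" where
  "div_vec a x t = (\<Sum>i\<in>UNIV. dx i (\<lambda>x t. a x t $ i) x t)"

text \<open>The divergence of a tensor acts on its first index, and the gradient of a vector field
  has the derivative as its first index.\<close>

definition div_ten :: "'n::finite tensor_field \<Rightarrow> 'n vector_field" where
  "div_ten A x t = (\<chi> j. \<Sum>i\<in>UNIV. dx i (\<lambda>x t. A x t $ i $ j) x t)"

definition grad_vec :: "'n::finite vector_field \<Rightarrow> 'n tensor_field" where
  "grad_vec a x t = (\<chi> i j. dx i (\<lambda>x t. a x t $ j) x t)"

text \<open>\<open>advect a b\<close> is the field written \<open>(a \<cdot> \<nabla>) b\<close>.\<close>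

definition advect :: "'n::finite vector_field \<Rightarrow> 'n vector_field \<Rightarrow> 'n vector_field" where
  "advect a b x t = (\<chi> j. \<Sum>i\<in>UNIV. a x t $ i * dx i (\<lambda>x t. b x t $ j) x t)"

definition tensor_prod :: "real^'n::finite \<Rightarrow> real^'n \<Rightarrow> real^'n^'n" (infixl "\<otimes>" 75) where
  "a \<otimes> b = (\<chi> i j. a $ i * b $ j)"

definition double_dot :: "real^'n::finite^'n \<Rightarrow> real^'n^'n \<Rightarrow> real" (infixl "\<Colon>\<Colon>" 70) where
  "A \<Colon>\<Colon> C = (\<Sum>i\<in>UNIV. \<Sum>j\<in>UNIV. A $ i $ j * C $ i $ j)"

text \<open>Partial derivatives of functions of the density and the temperature.\<close>

definition d_rho :: "(real \<Rightarrow> real \<Rightarrow> real) \<Rightarrow> real \<Rightarrow> real \<Rightarrow> real" where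
  "d_rho g r s = deriv (\<lambda>r'. g r' s) r"

definition d_theta :: "(real \<Rightarrow> real \<Rightarrow> real) \<Rightarrow> real \<Rightarrow> real \<Rightarrow> real" where
  "d_theta g r s = deriv (\<lambda>s'. g r s') s"


section \<open>Smoothness\<close>

text \<open>The set \<open>D\<close> is meant to be open in \<open>\<real>\<^sup>n \<times> \<real>\<close>. \<open>Cx k D f\<close>: the spatial derivatives of \<open>f\<close> of
  order at most \<open>k\<close> exist and are continuous in \<open>(x, t)\<close>.  The existence has to be required
  explicitly because \<^term>\<open>deriv\<close> is total.\<close>

primrec Cx :: "nat \<Rightarrow> ((real^'n::finite) \<times> real) set \<Rightarrow> 'n scalar_field \<Rightarrow> bool" where
  "Cx 0 D f \<longleftrightarrow> continuous_on D (\<lambda>(x, t). f x t)"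
| "Cx (Suc k) D f \<longleftrightarrow> continuous_on D (\<lambda>(x, t). f x t) \<and>
     (\<forall>i. (\<forall>(x, t)\<in>D. (\<lambda>h. f (x + h *\<^sub>R axis i 1) t) field_differentiable (at 0)) \<and>
          Cx k D (dx i f))"

definition C1t :: "((real^'n::finite) \<times> real) set \<Rightarrow> 'n scalar_field \<Rightarrow> bool" where
  "C1t D f \<longleftrightarrow> (\<forall>(x, t)\<in>D. (\<lambda>s. f x s) field_differentiable (at t)) \<and>
     continuous_on D (\<lambda>(x, t). dt f x t)"

definition C1_on :: "'a::real_normed_vector set \<Rightarrow> ('a \<Rightarrow> real) \<Rightarrow> bool" where
  "C1_on S f \<longleftrightarrow> (\<exists>f'. (\<forall>z\<in>S. (f has_derivative blinfun_apply (f' z)) (at z)) \<and>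
     continuous_on S f')"

definition C1_state :: "(real \<Rightarrow> real \<Rightarrow> real) \<Rightarrow> bool" where
  "C1_state g \<longleftrightarrow> C1_on ({0<..} \<times> {0<..}) (\<lambda>(r, s). g r s)"

definition C2_state :: "(real \<Rightarrow> real \<Rightarrow> real) \<Rightarrow> bool" where
  "C2_state g \<longleftrightarrow> C1_state g \<and> C1_state (d_rho g) \<and> C1_state (d_theta g)"


section \<open>Data and unknowns\<close>

record ('n::finite) mgd_data =
  press :: "real \<Rightarrow> real \<Rightarrow> real"
  inten :: "real \<Rightarrow> real \<Rightarrow> real"
  cond  :: "real \<Rightarrow> real \<Rightarrow> real"
  visc  :: "real \<Rightarrow> real \<Rightarrow> real"
  bulk  :: "real \<Rightarrow> real \<Rightarrow> real"
  relax :: "real \<Rightarrow> real \<Rightarrow> real^'n \<Rightarrow> real^'n \<Rightarrow> real"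
  force :: "'n vector_field"
  heat  :: "'n scalar_field"

text \<open>The data are \<open>p\<close>, \<open>\<epsilon>\<close>, \<open>\<kappa>\<close>, \<open>\<mu>\<close>, \<open>\<lambda>\<close> as functions of \<open>(\<rho>, \<theta>)\<close>, then
  \<open>\<tau>\<close> as a function of \<open>(\<rho>, \<epsilon>, u, B)\<close>, and \<open>F\<close>, \<open>Q\<close>; the unknowns below are \<open>\<rho>\<close>, \<open>u\<close>, \<open>\<theta>\<close>, \<open>B\<close>.\<close>

record ('n::finite) mgd = "'n mgd_data" +
  rho :: "'n scalar_field"
  vel :: "'n vector_field"
  temp :: "'n scalar_field"
  mag :: "'n vector_field"

definition at_state :: "(real \<Rightarrow> real \<Rightarrow> real) \<Rightarrow> 'n::finite mgd \<Rightarrow> 'n scalar_field" where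
  "at_state g M x t = g (rho M x t) (temp M x t)"

definition pressure :: "'n::finite mgd \<Rightarrow> 'n scalar_field" where
  "pressure M = at_state (press M) M"

definition int_energy :: "'n::finite mgd \<Rightarrow> 'n scalar_field" where
  "int_energy M = at_state (inten M) M"

definition tau :: "'n::finite mgd \<Rightarrow> 'n scalar_field" where
  "tau M x t = relax M (rho M x t) (int_energy M x t) (vel M x t) (mag M x t)"

definition tot_energy :: "'n::finite mgd \<Rightarrow> 'n scalar_field" where
  "tot_energy M x t = 1/2 * rho M x t * (norm (vel M x t))\<^sup>2 + rho M x t * int_energy M x t"

definition mag_energy :: "'n::finite mgd \<Rightarrow> 'n scalar_field" where
  "mag_energy M x t = 1/2 * (norm (mag M x t))\<^sup>2"

text \<open>\<open>sound_sq\<close> is \<open>C\<^sub>s\<^sup>2\<close> (only the square occurs in the equations).\<close>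

definition sound_sq :: "'n::finite mgd \<Rightarrow> 'n scalar_field" where
  "sound_sq M x t = at_state (d_rho (press M)) M x t +
     temp M x t * (at_state (d_theta (press M)) M x t)\<^sup>2 /
       ((rho M x t)\<^sup>2 * at_state (d_theta (inten M)) M x t)"

definition beta :: "'n::finite mgd \<Rightarrow> 'n vector_field" where
  "beta M = div_ten (\<lambda>x t. vel M x t \<otimes> mag M x t - mag M x t \<otimes> vel M x t)"

definition w_reg :: "'n::finite mgd \<Rightarrow> 'n vector_field" where
  "w_reg M x t = (tau M x t / rho M x t) *\<^sub>R
     (div_ten (\<lambda>x t. (rho M x t *\<^sub>R vel M x t) \<otimes> vel M x t - mag M x t \<otimes> mag M x t) x t
      + grad (\<lambda>x t. pressure M x t + mag_energy M x t) x t
      - rho M x t *\<^sub>R force M x t)"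

definition w_hat :: "'n::finite mgd \<Rightarrow> 'n vector_field" where
  "w_hat M x t = (tau M x t / rho M x t) *\<^sub>R
     (rho M x t *\<^sub>R advect (vel M) (vel M) x t
      - div_ten (\<lambda>x t. mag M x t \<otimes> mag M x t) x t
      + grad (\<lambda>x t. pressure M x t + mag_energy M x t) x t
      - rho M x t *\<^sub>R force M x t)"

definition strain :: "'n::finite vector_field \<Rightarrow> 'n tensor_field" where
  "strain a x t = (1/2) *\<^sub>R (grad_vec a x t + transpose (grad_vec a x t))"

definition stress_NS :: "'n::finite mgd \<Rightarrow> 'n tensor_field" where
  "stress_NS M x t =
     at_state (visc M) M x t *\<^sub>R
       (2 *\<^sub>R strain (vel M) x t - (2/3 * div_vec (vel M) x t) *\<^sub>R mat 1)
     + (at_state (bulk M) M x t * div_vec (vel M) x t) *\<^sub>R mat 1"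

definition stress :: "'n::finite mgd \<Rightarrow> 'n tensor_field" where
  "stress M x t =
     stress_NS M x t
     + (rho M x t *\<^sub>R vel M x t) \<otimes> w_hat M x t
     - tau M x t *\<^sub>R (beta M x t \<otimes> mag M x t + mag M x t \<otimes> beta M x t)
     + (tau M x t *
         (vel M x t \<bullet> grad (pressure M) x t
          + rho M x t * sound_sq M x t * div_vec (vel M) x t
          + beta M x t \<bullet> mag M x t
          - at_state (d_theta (press M)) M x t /
              (rho M x t * at_state (d_theta (inten M)) M x t) * heat M x t)) *\<^sub>R mat 1"

text \<open>\<open>neg_q\<close> is \<open>- q\<close>, the quantity given by the constitutive relation.\<close>

definition neg_q :: "'n::finite mgd \<Rightarrow> 'n vector_field" where
  "neg_q M x t =
     at_state (cond M) M x t *\<^sub>R grad (temp M) x t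
     + (tau M x t *
         (rho M x t *
           (vel M x t \<bullet> grad (int_energy M) x t
            - pressure M x t / (rho M x t)\<^sup>2 * (vel M x t \<bullet> grad (rho M) x t))
          - heat M x t)) *\<^sub>R vel M x t"


section \<open>Standing assumptions and the regularized system\<close>

text \<open>The relaxation parameter is only constrained at the values \<open>(\<rho>, \<epsilon>)\<close> that occur for
  positive density and temperature; this set of values is open since \<open>\<epsilon>\<^sub>\<theta> > 0\<close>.\<close>

definition relax_dom :: "'n::finite mgd \<Rightarrow> (real \<times> real \<times> (real^'n) \<times> (real^'n)) set" where
  "relax_dom M = {(r, e, v, b). 0 < r \<and> (\<exists>s>0. e = inten M r s)}"

definition mgd_data_ok :: "(real^'n::finite) set \<Rightarrow> real \<Rightarrow> 'n mgd \<Rightarrow> bool" where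
  "mgd_data_ok \<Omega> T M \<longleftrightarrow>
     (\<forall>r>0. \<forall>s>0.
        press M r s = s * d_theta (press M) r s + r\<^sup>2 * d_rho (inten M) r s \<and>
        d_rho (press M) r s \<ge> 0 \<and> d_theta (inten M) r s > 0 \<and>
        cond M r s \<ge> 0 \<and> visc M r s \<ge> 0 \<and> bulk M r s \<ge> 0) \<and>
     (\<forall>(r, e, v, b)\<in>relax_dom M. relax M r e v b > 0) \<and>
     (\<forall>x\<in>\<Omega>. \<forall>t\<in>{0<..<T}. heat M x t \<ge> 0)"

text \<open>All derivatives that appear in the system and in the internal energy balance exist and are
  continuous: first and second order in \<open>x\<close> and first order in \<open>t\<close> for the unknowns.\<close>

definition mgd_smooth :: "(real^'n::finite) set \<Rightarrow> real \<Rightarrow> 'n mgd \<Rightarrow> bool" where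
  "mgd_smooth \<Omega> T M \<longleftrightarrow>
     (let D = \<Omega> \<times> {0<..<T} in
       C2_state (press M) \<and> C2_state (inten M) \<and>
       C1_state (cond M) \<and> C1_state (visc M) \<and> C1_state (bulk M) \<and>
       C1_on (relax_dom M) (\<lambda>(r, e, v, b). relax M r e v b) \<and>
       (\<forall>j. Cx 1 D (\<lambda>x t. force M x t $ j)) \<and> Cx 1 D (heat M) \<and>
       Cx 2 D (rho M) \<and> C1t D (rho M) \<and>
       Cx 2 D (temp M) \<and> C1t D (temp M) \<and>
       (\<forall>j. Cx 2 D (\<lambda>x t. vel M x t $ j) \<and> C1t D (\<lambda>x t. vel M x t $ j)) \<and>
       (\<forall>j. Cx 2 D (\<lambda>x t. mag M x t $ j) \<and> C1t D (\<lambda>x t. mag M x t $ j)))"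

definition mass_eq :: "'n::finite mgd \<Rightarrow> real^'n \<Rightarrow> real \<Rightarrow> bool" where
  "mass_eq M x t \<longleftrightarrow>
     dt (rho M) x t + div_vec (\<lambda>x t. rho M x t *\<^sub>R (vel M x t - w_reg M x t)) x t = 0"

definition momentum_eq :: "'n::finite mgd \<Rightarrow> real^'n \<Rightarrow> real \<Rightarrow> bool" where
  "momentum_eq M x t \<longleftrightarrow>
     dt_vec (\<lambda>x t. rho M x t *\<^sub>R vel M x t) x t
     + div_ten (\<lambda>x t. (rho M x t *\<^sub>R (vel M x t - w_reg M x t)) \<otimes> vel M x t
                      - mag M x t \<otimes> mag M x t) x t
     + grad (\<lambda>x t. pressure M x t + mag_energy M x t) x t
     = div_ten (stress M) x t
       + (rho M x t - tau M x t * div_vec (\<lambda>x t. rho M x t *\<^sub>R vel M x t) x t) *\<^sub>R force M x t"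

definition energy_eq :: "'n::finite mgd \<Rightarrow> real^'n \<Rightarrow> real \<Rightarrow> bool" where
  "energy_eq M x t \<longleftrightarrow>
     dt (\<lambda>x t. tot_energy M x t + mag_energy M x t) x t
     + div_vec (\<lambda>x t. (tot_energy M x t + pressure M x t) *\<^sub>R (vel M x t - w_reg M x t)
                      + (norm (mag M x t))\<^sup>2 *\<^sub>R (vel M x t - w_hat M x t)
                      - ((vel M x t - w_hat M x t) \<bullet> mag M x t) *\<^sub>R mag M x t) x t
     = div_vec (\<lambda>x t. neg_q M x t
                      + (tau M x t * (beta M x t \<bullet> mag M x t)) *\<^sub>R vel M x t
                      + stress M x t *v vel M x t) x t
       + rho M x t * ((vel M x t - w_reg M x t) \<bullet> force M x t) + heat M x t"

definition magnetic_eq :: "'n::finite mgd \<Rightarrow> real^'n \<Rightarrow> real \<Rightarrow> bool" where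
  "magnetic_eq M x t \<longleftrightarrow>
     dt_vec (mag M) x t
     + div_ten (\<lambda>x t. (vel M x t - w_hat M x t) \<otimes> mag M x t
                      - mag M x t \<otimes> (vel M x t - w_hat M x t)) x t
     = div_ten (\<lambda>x t. tau M x t *\<^sub>R (vel M x t \<otimes> beta M x t - beta M x t \<otimes> vel M x t)) x t"

definition mgd_solution :: "(real^'n::finite) set \<Rightarrow> real \<Rightarrow> 'n mgd \<Rightarrow> bool" where
  "mgd_solution \<Omega> T M \<longleftrightarrow>
     (\<forall>x\<in>\<Omega>. \<forall>t\<in>{0<..<T}.
        rho M x t > 0 \<and> temp M x t > 0 \<and>
        mass_eq M x t \<and> momentum_eq M x t \<and> energy_eq M x t \<and> magnetic_eq M x t \<and>
        div_vec (mag M) x t = 0)"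

end

(*
Contract the momentum equation with u, the magnetic equation with B, and multiply the mass equation
by |u|^2 / 2; subtracting the first two from the total energy equation and adding the third leaves
the internal energy.  The fluxes match by the product rule and div B = 0, except for
  div[tau (beta . B) u] - B . div[tau (u (x) beta - beta (x) u)]
    = div[tau (u . B) beta] + tau [(u . grad) B . beta - (beta . grad) B . u],
and the forcing terms match because w = w_hat + (tau / rho) div(rho u) u.
*)
theory Submission
  imports Defs
begin

section \<open>Partial differentiability\<close>

text \<open>The obstacle is that \<open>deriv\<close> is total: a product rule says something about
  \<open>dx\<close> or \<open>dt\<close> at a point only if every factor is differentiable there,
  and the system differentiates fields (w, w_hat, beta, q, Pi) that already contain first
  derivatives. Hence differentiability is tracked along coordinate lines, which is all that
  \<open>dx\<close> sees, and for first derivatives on a whole open set. Composition with the state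
  functions and with tau needs more, namely a total derivative of the outer function, and this is
  what the C1 classes supply. The balance itself rests on three identities for general
  differentiable fields, into which the equations are inserted afterwards. The terms with w and
  w_hat in the result come from mismatched velocities: the pressure gradient works at velocity u in
  the momentum equation but at u - w in the energy flux, and the Lorentz force div(B (x) B) -
  grad(|B|^2/2) works at u in the momentum equation but at u - w_hat in the magnetic one.\<close>

definition x_differentiable :: "'n::finite scalar_field \<Rightarrow> real^'n \<Rightarrow> real \<Rightarrow> bool" where
  "x_differentiable f x t \<longleftrightarrow> (\<forall>i. (\<lambda>h. f (x + h *\<^sub>R axis i 1) t) differentiable at 0)"

definition t_differentiable :: "'n::finite scalar_field \<Rightarrow> real^'n \<Rightarrow> real \<Rightarrow> bool" where
  "t_differentiable f x t \<longleftrightarrow> (\<lambda>s. f x s) differentiable at t"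

lemma x_differentiable_DERIV:
  assumes "x_differentiable f x t"
  shows "((\<lambda>h. f (x + h *\<^sub>R axis i 1) t) has_real_derivative dx i f x t) (at 0)"
  using assms unfolding x_differentiable_def dx_def
  by (metis DERIV_imp_deriv real_differentiable_def)

lemma t_differentiable_DERIV:
  assumes "t_differentiable f x t"
  shows "((\<lambda>s. f x s) has_real_derivative dt f x t) (at t)"
  using assms unfolding t_differentiable_def dt_def
  by (metis DERIV_imp_deriv real_differentiable_def)

lemma dx_eqI:
  assumes "((\<lambda>h. f (x + h *\<^sub>R axis i 1) t) has_real_derivative d) (at 0)"
  shows "dx i f x t = d"
  using assms unfolding dx_def by (rule DERIV_imp_deriv)

lemma dt_eqI:
  assumes "((\<lambda>s. f x s) has_real_derivative d) (at t)"
  shows "dt f x t = d"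
  using assms unfolding dt_def by (rule DERIV_imp_deriv)

lemma x_differentiableI:
  assumes "\<And>i. \<exists>d. ((\<lambda>h. f (x + h *\<^sub>R axis i 1) t) has_real_derivative d) (at 0)"
  shows "x_differentiable f x t"
  using assms unfolding x_differentiable_def by (metis real_differentiable_def)

lemma t_differentiableI:
  assumes "((\<lambda>s. f x s) has_real_derivative d) (at t)"
  shows "t_differentiable f x t"
  using assms unfolding t_differentiable_def by (metis real_differentiable_def)

named_theorems x_diff

lemma x_differentiable_const [x_diff]: "x_differentiable (\<lambda>x t. c) x t"
  by (simp add: x_differentiable_def)

lemma x_differentiable_add [x_diff]:
  "x_differentiable f x t \<Longrightarrow> x_differentiable g x t \<Longrightarrow> x_differentiable (\<lambda>x t. f x t + g x t) x t"
  by (simp add: x_differentiable_def)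

lemma x_differentiable_diff [x_diff]:
  "x_differentiable f x t \<Longrightarrow> x_differentiable g x t \<Longrightarrow> x_differentiable (\<lambda>x t. f x t - g x t) x t"
  by (simp add: x_differentiable_def)

lemma x_differentiable_mult [x_diff]:
  "x_differentiable f x t \<Longrightarrow> x_differentiable g x t \<Longrightarrow> x_differentiable (\<lambda>x t. f x t * g x t) x t"
  by (simp add: x_differentiable_def)

lemma x_differentiable_power [x_diff]:
  "x_differentiable f x t \<Longrightarrow> x_differentiable (\<lambda>x t. f x t ^ k) x t"
  by (simp add: x_differentiable_def)

lemma x_differentiable_divide [x_diff]:
  "x_differentiable f x t \<Longrightarrow> x_differentiable g x t \<Longrightarrow> g x t \<noteq> 0
    \<Longrightarrow> x_differentiable (\<lambda>x t. f x t / g x t) x t"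
  by (simp add: x_differentiable_def)

lemma x_differentiable_sum [x_diff]:
  "(\<And>k. k \<in> K \<Longrightarrow> x_differentiable (f k) x t) \<Longrightarrow> finite K
    \<Longrightarrow> x_differentiable (\<lambda>x t. \<Sum>k\<in>K. f k x t) x t"
  by (simp add: x_differentiable_def)

section \<open>Rules of calculus for the partial derivatives\<close>

lemma dx_add:
  assumes "x_differentiable f x t" "x_differentiable g x t"
  shows "dx i (\<lambda>x t. f x t + g x t) x t = dx i f x t + dx i g x t"
  by (rule dx_eqI, rule DERIV_add) (intro x_differentiable_DERIV assms)+

lemma dx_diff:
  assumes "x_differentiable f x t" "x_differentiable g x t"
  shows "dx i (\<lambda>x t. f x t - g x t) x t = dx i f x t - dx i g x t"
  by (rule dx_eqI, rule DERIV_diff) (intro x_differentiable_DERIV assms)+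

lemma dx_mult:
  assumes "x_differentiable f x t" "x_differentiable g x t"
  shows "dx i (\<lambda>x t. f x t * g x t) x t = dx i f x t * g x t + f x t * dx i g x t"
  by (rule dx_eqI)
    (use DERIV_mult[OF assms[THEN x_differentiable_DERIV, of i]] in \<open>simp add: algebra_simps\<close>)

lemma dx_const: "dx i (\<lambda>x t. c) x t = 0"
  by (simp add: dx_def)

lemma dx_sum:
  assumes "\<And>k. k \<in> K \<Longrightarrow> x_differentiable (f k) x t" "finite K"
  shows "dx i (\<lambda>x t. \<Sum>k\<in>K. f k x t) x t = (\<Sum>k\<in>K. dx i (f k) x t)"
  by (rule dx_eqI, rule DERIV_sum) (intro x_differentiable_DERIV assms)

lemma t_differentiable_add:
  "t_differentiable f x t \<Longrightarrow> t_differentiable g x t \<Longrightarrow> t_differentiable (\<lambda>x t. f x t + g x t) x t"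
  by (simp add: t_differentiable_def)

lemma t_differentiable_mult:
  "t_differentiable f x t \<Longrightarrow> t_differentiable g x t \<Longrightarrow> t_differentiable (\<lambda>x t. f x t * g x t) x t"
  by (simp add: t_differentiable_def)

lemma t_differentiable_const: "t_differentiable (\<lambda>x t. c) x t"
  by (simp add: t_differentiable_def)

lemma t_differentiable_sum:
  "(\<And>k. k \<in> K \<Longrightarrow> t_differentiable (f k) x t) \<Longrightarrow> finite K
    \<Longrightarrow> t_differentiable (\<lambda>x t. \<Sum>k\<in>K. f k x t) x t"
  by (simp add: t_differentiable_def)

lemma dt_add:
  assumes "t_differentiable f x t" "t_differentiable g x t"
  shows "dt (\<lambda>x t. f x t + g x t) x t = dt f x t + dt g x t"
  by (rule dt_eqI, rule DERIV_add) (intro t_differentiable_DERIV assms)+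

lemma dt_mult:
  assumes "t_differentiable f x t" "t_differentiable g x t"
  shows "dt (\<lambda>x t. f x t * g x t) x t = dt f x t * g x t + f x t * dt g x t"
  by (rule dt_eqI)
    (use DERIV_mult[OF assms[THEN t_differentiable_DERIV]] in \<open>simp add: algebra_simps\<close>)

lemma dt_const: "dt (\<lambda>x t. c) x t = 0"
  by (simp add: dt_def)

lemma dt_sum:
  assumes "\<And>k. k \<in> K \<Longrightarrow> t_differentiable (f k) x t" "finite K"
  shows "dt (\<lambda>x t. \<Sum>k\<in>K. f k x t) x t = (\<Sum>k\<in>K. dt (f k) x t)"
  by (rule dt_eqI, rule DERIV_sum) (intro t_differentiable_DERIV assms)

section \<open>Componentwise differentiability of vector and tensor fields\<close>

definition x_differentiable_vec :: "'n::finite vector_field \<Rightarrow> real^'n \<Rightarrow> real \<Rightarrow> bool" where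
  "x_differentiable_vec a x t \<longleftrightarrow> (\<forall>j. x_differentiable (\<lambda>x t. a x t $ j) x t)"

definition x_differentiable_ten :: "'n::finite tensor_field \<Rightarrow> real^'n \<Rightarrow> real \<Rightarrow> bool" where
  "x_differentiable_ten A x t \<longleftrightarrow> (\<forall>i j. x_differentiable (\<lambda>x t. A x t $ i $ j) x t)"

definition t_differentiable_vec :: "'n::finite vector_field \<Rightarrow> real^'n \<Rightarrow> real \<Rightarrow> bool" where
  "t_differentiable_vec a x t \<longleftrightarrow> (\<forall>j. t_differentiable (\<lambda>x t. a x t $ j) x t)"

lemma x_differentiable_vecI:
  "(\<And>j. x_differentiable (\<lambda>x t. a x t $ j) x t) \<Longrightarrow> x_differentiable_vec a x t"
  by (simp add: x_differentiable_vec_def)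

lemma x_differentiable_tenI:
  "(\<And>i j. x_differentiable (\<lambda>x t. A x t $ i $ j) x t) \<Longrightarrow> x_differentiable_ten A x t"
  by (simp add: x_differentiable_ten_def)

lemma x_differentiable_nth [x_diff]:
  "x_differentiable_vec a x t \<Longrightarrow> x_differentiable (\<lambda>x t. a x t $ j) x t"
  by (simp add: x_differentiable_vec_def)

lemma x_differentiable_nth_nth [x_diff]:
  "x_differentiable_ten A x t \<Longrightarrow> x_differentiable (\<lambda>x t. A x t $ i $ j) x t"
  by (simp add: x_differentiable_ten_def)

lemma x_differentiable_vec_add [x_diff]:
  "x_differentiable_vec a x t \<Longrightarrow> x_differentiable_vec b x t
    \<Longrightarrow> x_differentiable_vec (\<lambda>x t. a x t + b x t) x t"
  by (rule x_differentiable_vecI) (simp add: x_diff)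

lemma x_differentiable_vec_diff [x_diff]:
  "x_differentiable_vec a x t \<Longrightarrow> x_differentiable_vec b x t
    \<Longrightarrow> x_differentiable_vec (\<lambda>x t. a x t - b x t) x t"
  by (rule x_differentiable_vecI) (simp add: x_diff)

lemma x_differentiable_vec_scaleR [x_diff]:
  "x_differentiable f x t \<Longrightarrow> x_differentiable_vec a x t
    \<Longrightarrow> x_differentiable_vec (\<lambda>x t. f x t *\<^sub>R a x t) x t"
  by (rule x_differentiable_vecI) (simp add: x_diff)

lemma x_differentiable_vec_mult_ten [x_diff]:
  "x_differentiable_ten A x t \<Longrightarrow> x_differentiable_vec a x t
    \<Longrightarrow> x_differentiable_vec (\<lambda>x t. A x t *v a x t) x t"
  by (rule x_differentiable_vecI) (simp add: matrix_vector_mult_def x_diff)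

lemma x_differentiable_inner [x_diff]:
  "x_differentiable_vec a x t \<Longrightarrow> x_differentiable_vec b x t
    \<Longrightarrow> x_differentiable (\<lambda>x t. a x t \<bullet> b x t) x t"
  by (simp add: inner_vec_def x_diff)

lemma x_differentiable_norm_sq [x_diff]:
  "x_differentiable_vec a x t \<Longrightarrow> x_differentiable (\<lambda>x t. (norm (a x t))\<^sup>2) x t"
  by (simp add: power2_norm_eq_inner x_diff)

lemma x_differentiable_ten_add [x_diff]:
  "x_differentiable_ten A x t \<Longrightarrow> x_differentiable_ten B x t
    \<Longrightarrow> x_differentiable_ten (\<lambda>x t. A x t + B x t) x t"
  by (rule x_differentiable_tenI) (simp add: x_diff)

lemma x_differentiable_ten_diff [x_diff]:
  "x_differentiable_ten A x t \<Longrightarrow> x_differentiable_ten B x t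
    \<Longrightarrow> x_differentiable_ten (\<lambda>x t. A x t - B x t) x t"
  by (rule x_differentiable_tenI) (simp add: x_diff)

lemma x_differentiable_ten_scaleR [x_diff]:
  "x_differentiable f x t \<Longrightarrow> x_differentiable_ten A x t
    \<Longrightarrow> x_differentiable_ten (\<lambda>x t. f x t *\<^sub>R A x t) x t"
  by (rule x_differentiable_tenI) (simp add: x_diff)

lemma x_differentiable_ten_const [x_diff]: "x_differentiable_ten (\<lambda>x t. C) x t"
  by (rule x_differentiable_tenI) (simp add: x_diff)

lemma x_differentiable_ten_transpose [x_diff]:
  "x_differentiable_ten A x t \<Longrightarrow> x_differentiable_ten (\<lambda>x t. transpose (A x t)) x t"
  by (simp add: x_differentiable_ten_def transpose_def)

lemma x_differentiable_tensor_prod [x_diff]: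
  "x_differentiable_vec a x t \<Longrightarrow> x_differentiable_vec b x t
    \<Longrightarrow> x_differentiable_ten (\<lambda>x t. a x t \<otimes> b x t) x t"
  by (rule x_differentiable_tenI) (simp add: tensor_prod_def x_diff)

lemma t_differentiable_norm_sq:
  "t_differentiable_vec a x t \<Longrightarrow> t_differentiable (\<lambda>x t. (norm (a x t))\<^sup>2) x t"
  unfolding power2_norm_eq_inner inner_vec_def t_differentiable_vec_def
  by (simp add: t_differentiable_sum t_differentiable_mult)


section \<open>Vector calculus\<close>

lemma div_vec_add:
  assumes "x_differentiable_vec a x t" "x_differentiable_vec b x t"
  shows "div_vec (\<lambda>x t. a x t + b x t) x t = div_vec a x t + div_vec b x t"
  using assms by (simp add: div_vec_def dx_add x_diff sum.distrib)

lemma div_vec_diff: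
  assumes "x_differentiable_vec a x t" "x_differentiable_vec b x t"
  shows "div_vec (\<lambda>x t. a x t - b x t) x t = div_vec a x t - div_vec b x t"
  using assms by (simp add: div_vec_def dx_diff x_diff sum_subtractf)

lemma div_ten_diff:
  assumes "x_differentiable_ten A x t" "x_differentiable_ten B x t"
  shows "div_ten (\<lambda>x t. A x t - B x t) x t = div_ten A x t - div_ten B x t"
  using assms by (simp add: div_ten_def dx_diff x_diff sum_subtractf vec_eq_iff)

lemma grad_add:
  assumes "x_differentiable f x t" "x_differentiable g x t"
  shows "grad (\<lambda>x t. f x t + g x t) x t = grad f x t + grad g x t"
  using assms by (simp add: grad_def dx_add vec_eq_iff)

lemma grad_cmult:
  assumes "x_differentiable f x t"
  shows "grad (\<lambda>x t. k * f x t) x t = k *\<^sub>R grad f x t"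
  using assms by (simp add: grad_def dx_mult dx_const x_diff vec_eq_iff)

lemma div_vec_scaleR:
  assumes "x_differentiable f x t" "x_differentiable_vec a x t"
  shows "div_vec (\<lambda>x t. f x t *\<^sub>R a x t) x t = f x t * div_vec a x t + a x t \<bullet> grad f x t"
  using assms
  by (simp add: div_vec_def grad_def dx_mult x_diff sum.distrib inner_vec_def sum_distrib_left
      mult.commute add.commute)

text \<open>The divergence acts on the first index, so the first factor supplies both the divergence
  and the direction of transport, and the second one is transported.\<close>

lemma div_ten_tensor_prod:
  assumes "x_differentiable_vec a x t" "x_differentiable_vec b x t"
  shows "div_ten (\<lambda>x t. a x t \<otimes> b x t) x t = div_vec a x t *\<^sub>R b x t + advect a b x t"
  using assms
  by (simp add: div_ten_def div_vec_def advect_def tensor_prod_def dx_mult x_diff sum.distrib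
      vec_eq_iff sum_distrib_right)

lemma advect_scaleR: "advect (\<lambda>x t. f x t *\<^sub>R a x t) b x t = f x t *\<^sub>R advect a b x t"
  by (simp add: advect_def vec_eq_iff sum_distrib_left mult.assoc)

text \<open>Leibniz rule for the directional derivative along c. The gradient sums over directions
  outermost, the inner products with \<open>advect\<close> over components outermost, so the two
  sums are exchanged.\<close>

lemma inner_grad_inner:
  assumes "x_differentiable_vec a x t" "x_differentiable_vec b x t"
  shows "c x t \<bullet> grad (\<lambda>x t. a x t \<bullet> b x t) x t
    = advect c a x t \<bullet> b x t + a x t \<bullet> advect c b x t"
proof -
  have "c x t \<bullet> grad (\<lambda>x t. a x t \<bullet> b x t) x t
    = (\<Sum>i\<in>UNIV. \<Sum>j\<in>UNIV. c x t $ i * dx i (\<lambda>x t. a x t $ j) x t * b x t $ j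
        + a x t $ j * (c x t $ i * dx i (\<lambda>x t. b x t $ j) x t))"
    using assms
    by (simp add: grad_def inner_vec_def dx_sum dx_mult x_diff sum_distrib_left algebra_simps)
  also have "\<dots> = (\<Sum>j\<in>UNIV. \<Sum>i\<in>UNIV. c x t $ i * dx i (\<lambda>x t. a x t $ j) x t * b x t $ j
        + a x t $ j * (c x t $ i * dx i (\<lambda>x t. b x t $ j) x t))"
    by (rule sum.swap)
  also have "\<dots> = advect c a x t \<bullet> b x t + a x t \<bullet> advect c b x t"
    by (simp add: advect_def inner_vec_def sum.distrib sum_distrib_left sum_distrib_right)
  finally show ?thesis .
qed

lemma inner_grad_norm_sq:
  assumes "x_differentiable_vec a x t"
  shows "c x t \<bullet> grad (\<lambda>x t. (norm (a x t))\<^sup>2) x t = 2 * (a x t \<bullet> advect c a x t)"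
  using inner_grad_inner[OF assms assms, of c]
  by (simp add: power2_norm_eq_inner inner_commute)

lemma inner_grad_half_norm_sq:
  assumes "x_differentiable_vec a x t"
  shows "c x t \<bullet> grad (\<lambda>x t. 1/2 * (norm (a x t))\<^sup>2) x t = a x t \<bullet> advect c a x t"
  using inner_grad_norm_sq[OF assms, of c] x_differentiable_norm_sq[OF assms]
  by (simp only: grad_cmult inner_scaleR_right)

lemma dt_norm_sq:
  assumes "t_differentiable_vec a x t"
  shows "dt (\<lambda>x t. (norm (a x t))\<^sup>2) x t = 2 * (a x t \<bullet> dt_vec a x t)"
  using assms unfolding t_differentiable_vec_def power2_norm_eq_inner inner_vec_def
  by (simp add: dt_sum dt_mult t_differentiable_mult dt_vec_def sum.distrib sum_distrib_left
      algebra_simps)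

lemma dt_half_norm_sq:
  assumes "t_differentiable_vec a x t"
  shows "dt (\<lambda>x t. 1/2 * (norm (a x t))\<^sup>2) x t = a x t \<bullet> dt_vec a x t"
  using dt_mult[OF t_differentiable_const t_differentiable_norm_sq[OF assms], of "1/2"]
  by (simp only: dt_norm_sq[OF assms] dt_const)

lemma dt_vec_scaleR:
  assumes "t_differentiable f x t" "t_differentiable_vec a x t"
  shows "dt_vec (\<lambda>x t. f x t *\<^sub>R a x t) x t = dt f x t *\<^sub>R a x t + f x t *\<^sub>R dt_vec a x t"
  using assms unfolding t_differentiable_vec_def
  by (simp add: dt_vec_def dt_mult vec_eq_iff)

text \<open>\<open>*v\<close> contracts the second index of A, while \<open>div_ten\<close> and
  \<open>grad_vec\<close> carry the derivative on the first; with these conventions no transpose of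
  A arises. This matters because the stress, which contains rho u (x) w_hat, need not be
  symmetric.\<close>

lemma div_vec_matrix_vector_mult:
  assumes "x_differentiable_ten A x t" "x_differentiable_vec a x t"
  shows "div_vec (\<lambda>x t. A x t *v a x t) x t = a x t \<bullet> div_ten A x t + A x t \<Colon>\<Colon> grad_vec a x t"
proof -
  have "div_vec (\<lambda>x t. A x t *v a x t) x t
    = (\<Sum>i\<in>UNIV. \<Sum>j\<in>UNIV. a x t $ j * dx i (\<lambda>x t. A x t $ i $ j) x t)
      + A x t \<Colon>\<Colon> grad_vec a x t"
    using assms
    by (simp add: div_vec_def matrix_vector_mult_def dx_sum dx_mult x_diff double_dot_def
        grad_vec_def sum.distrib mult.commute)
  also have "(\<Sum>i\<in>UNIV. \<Sum>j\<in>UNIV. a x t $ j * dx i (\<lambda>x t. A x t $ i $ j) x t)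
    = a x t \<bullet> div_ten A x t"
    by (subst sum.swap) (simp add: inner_vec_def div_ten_def sum_distrib_left)
  finally show ?thesis .
qed

section \<open>Energy identities for general fields\<close>

text \<open>The left side is |u|^2/2 (dt r + div(r v)) + r u . (dt u + (v . grad) u). Contracting
  the momentum form with u produces the same transport term but the full |u|^2 in front of the mass
  balance, so half of it is taken off again. The velocity v is kept apart from u because mass is
  carried by u - w.\<close>

lemma kinetic_energy_balance:
  assumes "t_differentiable r x t" "t_differentiable_vec u x t"
    and "x_differentiable r x t" "x_differentiable_vec u x t" "x_differentiable_vec v x t"
  shows "dt (\<lambda>x t. 1/2 * r x t * (norm (u x t))\<^sup>2) x t
      + div_vec (\<lambda>x t. (1/2 * r x t * (norm (u x t))\<^sup>2) *\<^sub>R v x t) x t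
    = u x t \<bullet> (dt_vec (\<lambda>x t. r x t *\<^sub>R u x t) x t
                + div_ten (\<lambda>x t. (r x t *\<^sub>R v x t) \<otimes> u x t) x t)
      - 1/2 * (norm (u x t))\<^sup>2 * (dt r x t + div_vec (\<lambda>x t. r x t *\<^sub>R v x t) x t)"
proof -
  \<comment> \<open>The flux is regrouped so that the mass flux r v stays one factor; only |u|^2/2
    is then differentiated along it.\<close>
  have "div_vec (\<lambda>x t. (1/2 * r x t * (norm (u x t))\<^sup>2) *\<^sub>R v x t) x t
    = div_vec (\<lambda>x t. (1/2 * (norm (u x t))\<^sup>2) *\<^sub>R r x t *\<^sub>R v x t) x t"
    by (simp add: mult_ac)
  also have "\<dots> = 1/2 * (norm (u x t))\<^sup>2 * div_vec (\<lambda>x t. r x t *\<^sub>R v x t) x t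
      + r x t * (u x t \<bullet> advect v u x t)"
    using assms(3-)
    by (subst div_vec_scaleR)
      (simp_all only: x_diff inner_scaleR_left inner_grad_half_norm_sq advect_scaleR
        inner_scaleR_right)
  finally have 1: "div_vec (\<lambda>x t. (1/2 * r x t * (norm (u x t))\<^sup>2) *\<^sub>R v x t) x t
    = 1/2 * (norm (u x t))\<^sup>2 * div_vec (\<lambda>x t. r x t *\<^sub>R v x t) x t
      + r x t * (u x t \<bullet> advect v u x t)" .
  have half: "t_differentiable (\<lambda>x t. 1/2 * (norm (u x t))\<^sup>2) x t"
    by (intro t_differentiable_mult t_differentiable_const t_differentiable_norm_sq assms)
  have "(\<lambda>x t. 1/2 * r x t * (norm (u x t))\<^sup>2) = (\<lambda>x t. r x t * (1/2 * (norm (u x t))\<^sup>2))"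
    by (simp add: fun_eq_iff)
  then have 2: "dt (\<lambda>x t. 1/2 * r x t * (norm (u x t))\<^sup>2) x t
    = dt r x t * (1/2 * (norm (u x t))\<^sup>2) + r x t * (u x t \<bullet> dt_vec u x t)"
    by (simp only: dt_mult[OF assms(1) half] dt_half_norm_sq[OF assms(2)])
  have 3: "div_ten (\<lambda>x t. (r x t *\<^sub>R v x t) \<otimes> u x t) x t
    = div_vec (\<lambda>x t. r x t *\<^sub>R v x t) x t *\<^sub>R u x t + r x t *\<^sub>R advect v u x t"
    using assms(3-) by (simp add: div_ten_tensor_prod x_diff advect_scaleR)
  show ?thesis
    unfolding 1 2 3 using assms(1,2)
    by (simp add: dt_vec_scaleR inner_add_right power2_norm_eq_inner algebra_simps)
qed

text \<open>A Poynting-type identity. Expanding both divergences, |b|^2 div c and b . (b . grad) c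
  agree, and the excess of the energy flux over the contracted induction term is b . (c . grad) b -
  c . (b . grad) b. The first of these is c . grad(|b|^2/2); since div b = 0, (b . grad) b is div(b
  (x) b). The excess is thus minus the work of the Lorentz force at velocity c.\<close>

lemma magnetic_energy_balance:
  assumes "t_differentiable_vec b x t" "x_differentiable_vec b x t" "x_differentiable_vec c x t"
    and "div_vec b x t = 0"
  shows "dt (\<lambda>x t. 1/2 * (norm (b x t))\<^sup>2) x t
      + div_vec (\<lambda>x t. (norm (b x t))\<^sup>2 *\<^sub>R c x t - (c x t \<bullet> b x t) *\<^sub>R b x t) x t
    = b x t \<bullet> (dt_vec b x t + div_ten (\<lambda>x t. c x t \<otimes> b x t - b x t \<otimes> c x t) x t)
      + c x t \<bullet> (grad (\<lambda>x t. 1/2 * (norm (b x t))\<^sup>2) x t - div_ten (\<lambda>x t. b x t \<otimes> b x t) x t)"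
  unfolding dt_half_norm_sq[OF assms(1)] inner_diff_right inner_grad_half_norm_sq[OF assms(2)]
  using assms(2-)
  by (simp add: div_vec_diff div_vec_scaleR div_ten_diff div_ten_tensor_prod x_diff
      inner_grad_inner inner_grad_norm_sq inner_add_right inner_diff_right inner_commute
      power2_norm_eq_inner[symmetric])

text \<open>The tensor is antisymmetric in u and c, so a single flux identity, used for (u, c) and
  again for (c, u), gives everything: b . div((k u) (x) c) cancels, while b . div((k c) (x) u) turns
  into the flux on the right.\<close>

lemma relaxation_work_balance:
  assumes "x_differentiable k x t" "x_differentiable_vec u x t"
    and "x_differentiable_vec b x t" "x_differentiable_vec c x t"
  shows "div_vec (\<lambda>x t. (k x t * (c x t \<bullet> b x t)) *\<^sub>R u x t) x t
      - b x t \<bullet> div_ten (\<lambda>x t. k x t *\<^sub>R (u x t \<otimes> c x t - c x t \<otimes> u x t)) x t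
    = div_vec (\<lambda>x t. (k x t * (u x t \<bullet> b x t)) *\<^sub>R c x t) x t
      + k x t * (advect u b x t \<bullet> c x t - advect c b x t \<bullet> u x t)"
proof -
  \<comment> \<open>Both sides contain (c . b) div(k u) and k c . stuff-free transport of c along u;
    the remainder is the derivative of b along u, paired with c. The fields u and c are bound anew
    so that their roles can be exchanged.\<close>
  have flux: "div_vec (\<lambda>x t. (k x t * (c x t \<bullet> b x t)) *\<^sub>R u x t) x t
      = b x t \<bullet> div_ten (\<lambda>x t. (k x t *\<^sub>R u x t) \<otimes> c x t) x t
        + k x t * (advect u b x t \<bullet> c x t)"
    if "x_differentiable_vec u x t" "x_differentiable_vec c x t" for u c :: "'a vector_field"
  proof -
    have "div_vec (\<lambda>x t. (k x t * (c x t \<bullet> b x t)) *\<^sub>R u x t) x t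
      = div_vec (\<lambda>x t. (c x t \<bullet> b x t) *\<^sub>R k x t *\<^sub>R u x t) x t"
      by (simp add: mult.commute)
    also have "\<dots> = (c x t \<bullet> b x t) * div_vec (\<lambda>x t. k x t *\<^sub>R u x t) x t
        + k x t * (u x t \<bullet> grad (\<lambda>x t. c x t \<bullet> b x t) x t)"
      using assms(1,3) that by (subst div_vec_scaleR) (simp_all add: x_diff)
    also have "\<dots> = b x t \<bullet> div_ten (\<lambda>x t. (k x t *\<^sub>R u x t) \<otimes> c x t) x t
        + k x t * (advect u b x t \<bullet> c x t)"
      using assms(1,3) that
      by (simp add: inner_grad_inner div_ten_tensor_prod x_diff advect_scaleR inner_add_right
          inner_commute algebra_simps)
    finally show ?thesis .
  qed
  \<comment> \<open>The scalar k goes to the first factor of each product, the one that meets the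
    divergence, to match \<open>flux\<close>.\<close>
  have "(\<lambda>x t. k x t *\<^sub>R (u x t \<otimes> c x t - c x t \<otimes> u x t))
    = (\<lambda>x t. (k x t *\<^sub>R u x t) \<otimes> c x t - (k x t *\<^sub>R c x t) \<otimes> u x t)"
    by (simp add: fun_eq_iff vec_eq_iff tensor_prod_def algebra_simps)
  then have split: "div_ten (\<lambda>x t. k x t *\<^sub>R (u x t \<otimes> c x t - c x t \<otimes> u x t)) x t
    = div_ten (\<lambda>x t. (k x t *\<^sub>R u x t) \<otimes> c x t) x t
      - div_ten (\<lambda>x t. (k x t *\<^sub>R c x t) \<otimes> u x t) x t"
    using assms by (simp add: div_ten_diff x_diff)
  show ?thesis
    unfolding split inner_diff_right flux[OF assms(2,4)] flux[OF assms(4,2)]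
    by (simp add: right_diff_distrib)
qed


section \<open>Second order differentiability\<close>

text \<open>The condition is posed on a set rather than at a point, since differentiating
  \<open>dx i f\<close> at x involves the values of \<open>dx i f\<close> near x.\<close>

definition twice_x_differentiable ::
    "(real^'n::finite) set \<Rightarrow> real set \<Rightarrow> 'n scalar_field \<Rightarrow> bool" where
  "twice_x_differentiable \<Omega> I f \<longleftrightarrow>
     (\<forall>x\<in>\<Omega>. \<forall>t\<in>I. x_differentiable f x t \<and> (\<forall>i. x_differentiable (dx i f) x t))"

text \<open>Differentiability is local. This lets a formula for \<open>dx i f\<close> that holds
  only on \<Omega>, such as a product rule, be differentiated once more.\<close>

lemma x_differentiable_cong:
  assumes "open \<Omega>" "x \<in> \<Omega>" "\<And>y. y \<in> \<Omega> \<Longrightarrow> f y t = g y t" "x_differentiable g x t"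
  shows "x_differentiable f x t"
proof (rule x_differentiableI)
  fix i
  \<comment> \<open>The coordinate line through x stays in \<Omega> for all h in this open set,
    which contains 0.\<close>
  have "open ((\<lambda>h. x + h *\<^sub>R axis i 1) -` \<Omega>)"
    using assms(1) by (intro open_vimage continuous_intros) auto
  from has_field_derivative_transform_within_open[OF x_differentiable_DERIV[OF assms(4)] this]
  have "((\<lambda>h. f (x + h *\<^sub>R axis i 1) t) has_real_derivative dx i g x t) (at 0)"
    using assms(2) by (simp add: assms(3))
  then show "\<exists>d. ((\<lambda>h. f (x + h *\<^sub>R axis i 1) t) has_real_derivative d) (at 0)" ..
qed

lemma twice_x_differentiableD:
  assumes "twice_x_differentiable \<Omega> I f" "x \<in> \<Omega>" "t \<in> I"
  shows "x_differentiable f x t" "x_differentiable (dx i f) x t"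
  using assms by (auto simp: twice_x_differentiable_def)

lemma twice_x_differentiableI:
  assumes "open \<Omega>" "\<And>x t. x \<in> \<Omega> \<Longrightarrow> t \<in> I \<Longrightarrow> x_differentiable f x t"
    and "\<And>i x t. x \<in> \<Omega> \<Longrightarrow> t \<in> I \<Longrightarrow> dx i f x t = g i x t"
    and "\<And>i x t. x \<in> \<Omega> \<Longrightarrow> t \<in> I \<Longrightarrow> x_differentiable (g i) x t"
  shows "twice_x_differentiable \<Omega> I f"
proof -
  have "x_differentiable (dx i f) x t" if "x \<in> \<Omega>" "t \<in> I" for i x t
    using assms(1) that(1) assms(3)[OF _ that(2)] assms(4)[OF that]
    by (rule x_differentiable_cong)
  then show ?thesis
    using assms(2) by (simp add: twice_x_differentiable_def)
qed

lemma twice_x_differentiable_const: "twice_x_differentiable \<Omega> I (\<lambda>x t. c)"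
proof -
  have "dx i (\<lambda>x t. c) = (\<lambda>x t. 0)" for i :: 'a
    by (simp add: fun_eq_iff dx_const)
  then show ?thesis
    by (simp add: twice_x_differentiable_def x_diff)
qed

lemma twice_x_differentiable_add:
  assumes "open \<Omega>" "twice_x_differentiable \<Omega> I f" "twice_x_differentiable \<Omega> I g"
  shows "twice_x_differentiable \<Omega> I (\<lambda>x t. f x t + g x t)"
  using assms
  by (intro twice_x_differentiableI[where g = "\<lambda>i x t. dx i f x t + dx i g x t"])
    (simp_all add: twice_x_differentiable_def dx_add x_diff)

lemma twice_x_differentiable_diff:
  assumes "open \<Omega>" "twice_x_differentiable \<Omega> I f" "twice_x_differentiable \<Omega> I g"
  shows "twice_x_differentiable \<Omega> I (\<lambda>x t. f x t - g x t)"
  using assms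
  by (intro twice_x_differentiableI[where g = "\<lambda>i x t. dx i f x t - dx i g x t"])
    (simp_all add: twice_x_differentiable_def dx_diff x_diff)

lemma twice_x_differentiable_mult:
  assumes "open \<Omega>" "twice_x_differentiable \<Omega> I f" "twice_x_differentiable \<Omega> I g"
  shows "twice_x_differentiable \<Omega> I (\<lambda>x t. f x t * g x t)"
  using assms
  by (intro twice_x_differentiableI[where g = "\<lambda>i x t. dx i f x t * g x t + f x t * dx i g x t"])
    (simp_all add: twice_x_differentiable_def dx_mult x_diff)

lemma twice_x_differentiable_sum:
  assumes "open \<Omega>" "finite K" "\<And>k. k \<in> K \<Longrightarrow> twice_x_differentiable \<Omega> I (f k)"
  shows "twice_x_differentiable \<Omega> I (\<lambda>x t. \<Sum>k\<in>K. f k x t)"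
  using assms
  by (intro twice_x_differentiableI[where g = "\<lambda>i x t. \<Sum>k\<in>K. dx i (f k) x t"])
    (simp_all add: twice_x_differentiable_def dx_sum x_diff)

lemma twice_x_differentiable_norm_sq:
  assumes "open \<Omega>" "\<And>j. twice_x_differentiable \<Omega> I (\<lambda>x t. a x t $ j)"
  shows "twice_x_differentiable \<Omega> I (\<lambda>x t. (norm (a x t))\<^sup>2)"
  unfolding power2_norm_eq_inner inner_vec_def inner_real_def
  by (intro twice_x_differentiable_sum twice_x_differentiable_mult assms) simp

lemma x_differentiable_vec_grad:
  assumes "twice_x_differentiable \<Omega> I f" "x \<in> \<Omega>" "t \<in> I"
  shows "x_differentiable_vec (grad f) x t"
  using assms by (simp add: x_differentiable_vec_def grad_def twice_x_differentiable_def)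

lemma x_differentiable_vec_div_ten:
  assumes "\<And>i j. twice_x_differentiable \<Omega> I (\<lambda>x t. A x t $ i $ j)" "x \<in> \<Omega>" "t \<in> I"
  shows "x_differentiable_vec (div_ten A) x t"
  unfolding div_ten_def [abs_def]
  by (rule x_differentiable_vecI)
    (simp add: x_differentiable_sum twice_x_differentiableD(2)[OF assms])

lemma x_differentiable_ten_grad_vec:
  assumes "\<And>j. twice_x_differentiable \<Omega> I (\<lambda>x t. a x t $ j)" "x \<in> \<Omega>" "t \<in> I"
  shows "x_differentiable_ten (grad_vec a) x t"
  using assms by (simp add: x_differentiable_ten_def grad_vec_def twice_x_differentiable_def)

lemma x_differentiable_div_vec:
  assumes "\<And>j. twice_x_differentiable \<Omega> I (\<lambda>x t. a x t $ j)" "x \<in> \<Omega>" "t \<in> I"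
  shows "x_differentiable (div_vec a) x t"
proof -
  have "x_differentiable (\<lambda>x t. \<Sum>i\<in>UNIV. dx i (\<lambda>x t. a x t $ i) x t) x t"
    by (intro x_differentiable_sum twice_x_differentiableD(2)[OF assms]) simp
  then show ?thesis
    by (simp add: div_vec_def [abs_def])
qed

lemma x_differentiable_vec_advect:
  assumes "x_differentiable_vec a x t"
    and "\<And>j. twice_x_differentiable \<Omega> I (\<lambda>x t. b x t $ j)" "x \<in> \<Omega>" "t \<in> I"
  shows "x_differentiable_vec (advect a b) x t"
  unfolding advect_def [abs_def]
  by (rule x_differentiable_vecI)
    (simp add: x_differentiable_sum x_differentiable_mult x_differentiable_nth[OF assms(1)]
      twice_x_differentiableD(2)[OF assms(2-)])

section \<open>From the smoothness classes to differentiability\<close>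

lemma Cx_Suc_x_differentiable:
  assumes "Cx (Suc k) (\<Omega> \<times> I) f" "x \<in> \<Omega>" "t \<in> I"
  shows "x_differentiable f x t"
  using assms by (auto simp: x_differentiable_def field_differentiable_def real_differentiable_def)

lemma Cx_2_twice_x_differentiable:
  assumes "Cx 2 (\<Omega> \<times> I) f"
  shows "twice_x_differentiable \<Omega> I f"
proof -
  have 2: "Cx (Suc (Suc 0)) (\<Omega> \<times> I) f"
    using assms by (simp only: numeral_2_eq_2)
  then have "Cx (Suc 0) (\<Omega> \<times> I) (dx i f)" for i
    by (simp only: Cx.simps(2)[of "Suc 0"])
  then show ?thesis
    using Cx_Suc_x_differentiable[OF 2] Cx_Suc_x_differentiable[of 0 \<Omega> I]
    by (simp only: twice_x_differentiable_def) blast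
qed

lemma C1t_t_differentiable:
  assumes "C1t (\<Omega> \<times> I) f" "x \<in> \<Omega>" "t \<in> I"
  shows "t_differentiable f x t"
  using assms
  by (auto simp: C1t_def t_differentiable_def field_differentiable_def real_differentiable_def)


section \<open>Functions of the state\<close>

text \<open>C1 on the open quadrant gives a total derivative G, hence the chain rule along every
  differentiable curve through the point. The partial derivatives, defined by \<open>deriv\<close>,
  are then recognised as values of G by the same chain rule along the two coordinate lines.\<close>

lemma C1_state_DERIV:
  assumes g: "C1_state g" and pos: "0 < f1 h" "0 < f2 h"
    and f1: "(f1 has_real_derivative d1) (at h)" and f2: "(f2 has_real_derivative d2) (at h)"
  shows "((\<lambda>h. g (f1 h) (f2 h)) has_real_derivative
    d_rho g (f1 h) (f2 h) * d1 + d_theta g (f1 h) (f2 h) * d2) (at h)"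
proof -
  obtain G where G: "((\<lambda>(r, s). g r s) has_derivative blinfun_apply G) (at (f1 h, f2 h))"
    using g pos unfolding C1_state_def C1_on_def by fastforce
  \<comment> \<open>The parameter z is free: the given curve passes the point at h, the coordinate
    lines at \<open>f1 h\<close> and \<open>f2 h\<close>.\<close>
  have chain: "((\<lambda>h. g (p h) (q h)) has_real_derivative blinfun_apply G (a, b)) (at z)"
    if "(p has_real_derivative a) (at z)" "(q has_real_derivative b) (at z)"
      "p z = f1 h" "q z = f2 h" for p q a b z
  proof -
    have "((\<lambda>h. (p h, q h)) has_derivative (\<lambda>y. (a * y, b * y))) (at z)"
      using that(1,2) unfolding has_field_derivative_def by (rule has_derivative_Pair)
    from has_derivative_compose[OF this, of "\<lambda>(r, s). g r s" "blinfun_apply G"] G that(3,4)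
    have "((\<lambda>h. g (p h) (q h)) has_derivative (\<lambda>y. blinfun_apply G (a * y, b * y))) (at z)"
      by simp
    moreover have "blinfun_apply G (a * y, b * y) = blinfun_apply G (a, b) * y" for y
      using blinfun.scaleR_right[of G y "(a, b)"] by (simp add: mult.commute)
    ultimately show ?thesis
      unfolding has_field_derivative_def by simp
  qed
  have "d_rho g (f1 h) (f2 h) = blinfun_apply G (1, 0)"
    unfolding d_rho_def
    by (rule DERIV_imp_deriv, rule chain[where p = "\<lambda>r. r" and z = "f1 h"]) auto
  moreover have "d_theta g (f1 h) (f2 h) = blinfun_apply G (0, 1)"
    unfolding d_theta_def
    by (rule DERIV_imp_deriv, rule chain[where q = "\<lambda>r. r" and z = "f2 h"]) auto
  moreover have "blinfun_apply G (d1, d2) = blinfun_apply G (1, 0) * d1 + blinfun_apply G (0, 1) * d2"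
    using blinfun.add_right[of G "d1 *\<^sub>R (1, 0)" "d2 *\<^sub>R (0, 1)"]
      blinfun.scaleR_right[of G d1 "(1, 0)"] blinfun.scaleR_right[of G d2 "(0, 1)"]
    by (simp add: mult.commute)
  ultimately show ?thesis
    using chain[OF f1 f2] by simp
qed

lemma at_state_DERIV_x:
  assumes "C1_state g" "0 < rho M x t" "0 < temp M x t"
    and "x_differentiable (rho M) x t" "x_differentiable (temp M) x t"
  shows "((\<lambda>h. at_state g M (x + h *\<^sub>R axis i 1) t) has_real_derivative
    at_state (d_rho g) M x t * dx i (rho M) x t + at_state (d_theta g) M x t * dx i (temp M) x t) (at 0)"
  using C1_state_DERIV[OF assms(1) _ _ assms(4,5)[THEN x_differentiable_DERIV], of i i] assms(2,3)
  by (simp add: at_state_def)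

lemma x_differentiable_at_state:
  assumes "C1_state g" "0 < rho M x t" "0 < temp M x t"
    and "x_differentiable (rho M) x t" "x_differentiable (temp M) x t"
  shows "x_differentiable (at_state g M) x t"
  by (rule x_differentiableI) (blast intro: at_state_DERIV_x[OF assms])

lemma t_differentiable_at_state:
  assumes "C1_state g" "0 < rho M x t" "0 < temp M x t"
    and "t_differentiable (rho M) x t" "t_differentiable (temp M) x t"
  shows "t_differentiable (at_state g M) x t"
  using C1_state_DERIV[OF assms(1-3) assms(4,5)[THEN t_differentiable_DERIV]]
  unfolding at_state_def [abs_def] by (rule t_differentiableI)

lemma twice_x_differentiable_at_state:
  assumes "open \<Omega>" "C2_state g"
    and pos: "\<And>x t. x \<in> \<Omega> \<Longrightarrow> t \<in> I \<Longrightarrow> 0 < rho M x t \<and> 0 < temp M x t"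
    and "twice_x_differentiable \<Omega> I (rho M)" "twice_x_differentiable \<Omega> I (temp M)"
  shows "twice_x_differentiable \<Omega> I (at_state g M)"
proof (rule twice_x_differentiableI[OF assms(1)])
  note d = twice_x_differentiableD[OF assms(4)] twice_x_differentiableD[OF assms(5)]
  fix x t i assume xt: "x \<in> \<Omega>" "t \<in> I"
  show "x_differentiable (at_state g M) x t"
    using assms(2) pos[OF xt] d[OF xt] by (simp add: C2_state_def x_differentiable_at_state)
  show "dx i (at_state g M) x t
    = at_state (d_rho g) M x t * dx i (rho M) x t + at_state (d_theta g) M x t * dx i (temp M) x t"
    using assms(2) pos[OF xt] d[OF xt] by (intro dx_eqI at_state_DERIV_x) (simp_all add: C2_state_def)
  show "x_differentiable (\<lambda>x t. at_state (d_rho g) M x t * dx i (rho M) x t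
    + at_state (d_theta g) M x t * dx i (temp M) x t) x t"
    using assms(2) pos[OF xt] d[OF xt]
    by (intro x_diff x_differentiable_at_state) (simp_all add: C2_state_def)
qed

lemma x_differentiable_vec_differentiable:
  assumes "x_differentiable_vec a x t"
  shows "(\<lambda>h. a (x + h *\<^sub>R axis i 1) t) differentiable at 0"
  using assms
  by (subst differentiable_componentwise_within)
    (auto simp: x_differentiable_vec_def x_differentiable_def Basis_vec_def inner_axis)

text \<open>The chain rule for a function of two scalars and two vectors: the four arguments form
  one differentiable curve in the product space, and \<open>relax M\<close> has a total derivative
  at its base point.\<close>

lemma x_differentiable_tau:
  assumes "C1_on (relax_dom M) (\<lambda>(r, e, v, b). relax M r e v b)"
    and "0 < rho M x t" "0 < temp M x t"
    and "x_differentiable (rho M) x t" "x_differentiable (int_energy M) x t"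
    and "x_differentiable_vec (vel M) x t" "x_differentiable_vec (mag M) x t"
  shows "x_differentiable (tau M) x t"
  unfolding x_differentiable_def
proof
  fix i
  let ?f = "\<lambda>h. (rho M (x + h *\<^sub>R axis i 1) t, int_energy M (x + h *\<^sub>R axis i 1) t,
    vel M (x + h *\<^sub>R axis i 1) t, mag M (x + h *\<^sub>R axis i 1) t)"
  have "?f differentiable at 0"
    using assms(4,5) assms(6,7)[THEN x_differentiable_vec_differentiable]
    by (simp add: x_differentiable_def differentiable_Pair)
  \<comment> \<open>The temperature at the point is the witness that this internal energy occurs at
    this density.\<close>
  moreover have "?f 0 \<in> relax_dom M"
    using assms(2,3) by (auto simp: relax_dom_def int_energy_def at_state_def)
  then have "(\<lambda>(r, e, v, b). relax M r e v b) differentiable at (?f 0)"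
    using assms(1) unfolding C1_on_def differentiable_def by blast
  ultimately have "(\<lambda>h. (\<lambda>(r, e, v, b). relax M r e v b) (?f h)) differentiable at 0"
    by (rule differentiable_compose[rotated])
  then show "(\<lambda>h. tau M (x + h *\<^sub>R axis i 1) t) differentiable at 0"
    by (simp add: tau_def)
qed


section \<open>The internal energy balance\<close>

locale regularized_mgd =
  fixes \<Omega> :: "(real^'n::finite) set" and T :: real and M :: "'n mgd"
  assumes open_dom: "open \<Omega>"
    and data_ok: "mgd_data_ok \<Omega> T M"
    and smooth: "mgd_smooth \<Omega> T M"
    and solution: "mgd_solution \<Omega> T M"
begin

abbreviation "I \<equiv> {0<..<T}"

lemma pos:
  assumes "x \<in> \<Omega>" "t \<in> I"
  shows "0 < rho M x t" "0 < temp M x t"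
  using solution assms by (simp_all add: mgd_solution_def)

lemma twice_unknowns:
  "twice_x_differentiable \<Omega> I (rho M)" "twice_x_differentiable \<Omega> I (temp M)"
  "twice_x_differentiable \<Omega> I (\<lambda>x t. vel M x t $ j)"
  "twice_x_differentiable \<Omega> I (\<lambda>x t. mag M x t $ j)"
  using smooth by (simp_all add: mgd_smooth_def Let_def Cx_2_twice_x_differentiable)

lemma state_smooth:
  "C2_state (press M)" "C2_state (inten M)"
  "C1_state (cond M)" "C1_state (visc M)" "C1_state (bulk M)"
  "C1_state (d_rho (press M))" "C1_state (d_theta (press M))" "C1_state (d_theta (inten M))"
  "C1_state (inten M)"
  using smooth by (simp_all add: mgd_smooth_def Let_def C2_state_def)

lemma twice_pressure: "twice_x_differentiable \<Omega> I (pressure M)"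
  unfolding pressure_def
  by (intro twice_x_differentiable_at_state open_dom state_smooth twice_unknowns) (simp add: pos)

lemma twice_int_energy: "twice_x_differentiable \<Omega> I (int_energy M)"
  unfolding int_energy_def
  by (intro twice_x_differentiable_at_state open_dom state_smooth twice_unknowns) (simp add: pos)

lemma twice_mag_energy: "twice_x_differentiable \<Omega> I (mag_energy M)"
  unfolding mag_energy_def [abs_def]
  by (intro twice_x_differentiable_mult twice_x_differentiable_norm_sq twice_x_differentiable_const
      open_dom twice_unknowns)

lemma twice_total_pressure:
  "twice_x_differentiable \<Omega> I (\<lambda>x t. pressure M x t + mag_energy M x t)"
  by (intro twice_x_differentiable_add open_dom twice_pressure twice_mag_energy)

section \<open>Differentiability of the constitutive fields at a fixed point\<close>

context
  fixes x :: "real^'n" and t :: real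
  assumes x: "x \<in> \<Omega>" and t: "t \<in> I"
begin

lemma x_differentiable_scalars [x_diff]:
  "x_differentiable (rho M) x t" "x_differentiable (temp M) x t"
  "x_differentiable (pressure M) x t" "x_differentiable (int_energy M) x t"
  "x_differentiable (mag_energy M) x t"
  by (intro twice_x_differentiableD(1)[OF _ x t] twice_unknowns twice_pressure twice_int_energy
      twice_mag_energy)+

lemma x_differentiable_vectors [x_diff]:
  "x_differentiable_vec (vel M) x t" "x_differentiable_vec (mag M) x t"
  unfolding x_differentiable_vec_def
  by (intro allI twice_x_differentiableD(1)[OF _ x t] twice_unknowns)+

text \<open>F enters w and w_hat, and Q enters Pi and q, without derivatives; one derivative of each
  is therefore enough.\<close>

lemma x_differentiable_data [x_diff]:
  "x_differentiable_vec (force M) x t" "x_differentiable (heat M) x t"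
  using smooth Cx_Suc_x_differentiable[OF _ x t, of 0]
  by (simp_all only: mgd_smooth_def Let_def x_differentiable_vec_def One_nat_def simp_thms)

text \<open>The divergence of Pi differentiates its viscosities and the state derivatives in
  \<open>sound_sq\<close> and in the heating term, that of q differentiates the
  conductivity.\<close>

lemma x_differentiable_coefficients [x_diff]:
  "x_differentiable (at_state (cond M) M) x t" "x_differentiable (at_state (visc M) M) x t"
  "x_differentiable (at_state (bulk M) M) x t"
  "x_differentiable (at_state (d_rho (press M)) M) x t"
  "x_differentiable (at_state (d_theta (press M)) M) x t"
  "x_differentiable (at_state (d_theta (inten M)) M) x t"
  by (intro x_differentiable_at_state state_smooth pos x_differentiable_scalars x t)+

lemma x_differentiable_gradients [x_diff]:
  "x_differentiable_vec (grad (rho M)) x t" "x_differentiable_vec (grad (temp M)) x t"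
  "x_differentiable_vec (grad (pressure M)) x t" "x_differentiable_vec (grad (int_energy M)) x t"
  "x_differentiable_vec (grad (\<lambda>x t. pressure M x t + mag_energy M x t)) x t"
  "x_differentiable_ten (grad_vec (vel M)) x t" "x_differentiable (div_vec (vel M)) x t"
  "x_differentiable_vec (advect (vel M) (vel M)) x t"
  by (intro x_differentiable_vec_grad[OF _ x t] x_differentiable_ten_grad_vec[OF _ x t]
      x_differentiable_div_vec[OF _ x t] x_differentiable_vec_advect[OF _ _ x t]
      twice_unknowns twice_pressure twice_int_energy twice_total_pressure
      x_differentiable_vectors)+

text \<open>The tensor entries are polynomials in twice differentiable components: one derivative is
  spent on the divergence and one is left.\<close>

lemma x_differentiable_fluxes [x_diff]:
  "x_differentiable_vec (beta M) x t"
  "x_differentiable_vec (div_ten (\<lambda>x t. mag M x t \<otimes> mag M x t)) x t"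
  "x_differentiable_vec
    (div_ten (\<lambda>x t. (rho M x t *\<^sub>R vel M x t) \<otimes> vel M x t - mag M x t \<otimes> mag M x t)) x t"
  unfolding beta_def
  by (rule x_differentiable_vec_div_ten[OF _ x t];
      simp only: tensor_prod_def vec_lambda_beta vector_minus_component vector_scaleR_component
        real_scaleR_def;
      intro twice_x_differentiable_mult twice_x_differentiable_diff twice_unknowns open_dom)+

text \<open>These are the denominators in w, w_hat, q, C_s^2 and the heating term of Pi; the second
  is positive by the condition on the derivative of the internal energy in theta.\<close>

lemma nonzero: "rho M x t \<noteq> 0" "at_state (d_theta (inten M)) M x t \<noteq> 0"
  using pos[OF x t] data_ok by (auto simp: mgd_data_ok_def at_state_def less_imp_neq[symmetric])

lemma x_differentiable_tau_M [x_diff]: "x_differentiable (tau M) x t"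
  using smooth
  by (intro x_differentiable_tau pos[OF x t] x_diff) (simp add: mgd_smooth_def Let_def)

lemma x_differentiable_w_hat [x_diff]: "x_differentiable_vec (w_hat M) x t"
  unfolding w_hat_def [abs_def] by (intro x_diff nonzero)

lemma x_differentiable_w_reg [x_diff]: "x_differentiable_vec (w_reg M) x t"
  unfolding w_reg_def [abs_def] by (intro x_diff nonzero)

lemma x_differentiable_stress [x_diff]: "x_differentiable_ten (stress M) x t"
  unfolding stress_def [abs_def] stress_NS_def [abs_def] strain_def [abs_def] sound_sq_def [abs_def]
  by (intro x_diff nonzero) (simp_all add: nonzero)

lemma x_differentiable_neg_q [x_diff]: "x_differentiable_vec (neg_q M) x t"
  unfolding neg_q_def [abs_def]
  by (intro x_diff nonzero) (simp_all add: nonzero)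

lemma t_differentiable_unknowns:
  "t_differentiable (rho M) x t" "t_differentiable (int_energy M) x t"
  "t_differentiable_vec (vel M) x t" "t_differentiable_vec (mag M) x t"
proof -
  have *: "t_differentiable f x t" if "C1t (\<Omega> \<times> I) f" for f
    using that x t by (rule C1t_t_differentiable)
  show "t_differentiable (rho M) x t" "t_differentiable_vec (vel M) x t"
    "t_differentiable_vec (mag M) x t"
    using smooth by (simp_all add: mgd_smooth_def Let_def t_differentiable_vec_def *)
  \<comment> \<open>The internal energy inherits its time derivative from rho and theta by the chain
    rule.\<close>
  show "t_differentiable (int_energy M) x t"
    unfolding int_energy_def using smooth
    by (intro t_differentiable_at_state state_smooth pos[OF x t] *)
      (simp_all add: mgd_smooth_def Let_def)
qed

text \<open>The two velocities differ only in the inertial term, in conservative form for w and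
  advective form for w_hat: div(rho u (x) u) = div(rho u) u + rho (u . grad) u.\<close>

lemma w_reg_eq:
  "w_reg M x t = w_hat M x t
    + (tau M x t / rho M x t * div_vec (\<lambda>x t. rho M x t *\<^sub>R vel M x t) x t) *\<^sub>R vel M x t"
proof -
  have split: "div_ten (\<lambda>x t. (rho M x t *\<^sub>R vel M x t) \<otimes> vel M x t - mag M x t \<otimes> mag M x t) x t
    = div_vec (\<lambda>x t. rho M x t *\<^sub>R vel M x t) x t *\<^sub>R vel M x t
      + rho M x t *\<^sub>R advect (vel M) (vel M) x t - div_ten (\<lambda>x t. mag M x t \<otimes> mag M x t) x t"
    by (subst div_ten_diff, (intro x_diff)+)
      (subst div_ten_tensor_prod[of "\<lambda>x t. rho M x t *\<^sub>R vel M x t"], (intro x_diff)+,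
        simp add: advect_scaleR)
  show ?thesis
    unfolding w_reg_def w_hat_def split using nonzero(1) by (simp add: algebra_simps)
qed

lemma internal_energy_balance:
  "dt (\<lambda>x t. rho M x t * int_energy M x t) x t
    + div_vec (\<lambda>x t. (rho M x t * int_energy M x t) *\<^sub>R (vel M x t - w_reg M x t)) x t
    + pressure M x t * div_vec (\<lambda>x t. vel M x t - w_reg M x t) x t
    = div_vec (\<lambda>x t. neg_q M x t + (tau M x t * (vel M x t \<bullet> mag M x t)) *\<^sub>R beta M x t) x t
      + stress M x t \<Colon>\<Colon> grad_vec (vel M) x t
      + w_reg M x t \<bullet> grad (pressure M) x t
      + (- div_ten (\<lambda>x t. mag M x t \<otimes> mag M x t) x t + grad (mag_energy M) x t
         - rho M x t *\<^sub>R force M x t) \<bullet> w_hat M x t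
      + tau M x t * (advect (vel M) (mag M) x t \<bullet> beta M x t
                     - advect (beta M) (mag M) x t \<bullet> vel M x t)
      + heat M x t"
proof -
  let ?v = "\<lambda>x t. vel M x t - w_reg M x t" and ?c = "\<lambda>x t. vel M x t - w_hat M x t"
  let ?k = "\<lambda>x t. 1/2 * rho M x t * (norm (vel M x t))\<^sup>2"
  let ?e = "\<lambda>x t. rho M x t * int_energy M x t"
  let ?BB = "\<lambda>x t. mag M x t \<otimes> mag M x t"
  let ?R = "div_ten (\<lambda>x t. tau M x t *\<^sub>R (vel M x t \<otimes> beta M x t - beta M x t \<otimes> vel M x t)) x t"
  let ?d = "div_vec (\<lambda>x t. rho M x t *\<^sub>R vel M x t) x t"
  have eqs: "mass_eq M x t" "momentum_eq M x t" "energy_eq M x t" "magnetic_eq M x t"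
    "div_vec (mag M) x t = 0"
    using solution x t by (simp_all add: mgd_solution_def)

  \<comment> \<open>With v = u - w the mass equation annihilates the last term of
    \<open>kinetic_energy_balance\<close>.\<close>
  have kinetic: "dt ?k x t + div_vec (\<lambda>x t. ?k x t *\<^sub>R ?v x t) x t
    = vel M x t \<bullet> dt_vec (\<lambda>x t. rho M x t *\<^sub>R vel M x t) x t
      + vel M x t \<bullet> div_ten (\<lambda>x t. (rho M x t *\<^sub>R ?v x t) \<otimes> vel M x t) x t"
    using kinetic_energy_balance[of "rho M" x t "vel M" ?v] eqs(1)
    by (simp add: mass_eq_def x_diff t_differentiable_unknowns inner_add_right)

  have "dt_vec (\<lambda>x t. rho M x t *\<^sub>R vel M x t) x t
      + (div_ten (\<lambda>x t. (rho M x t *\<^sub>R ?v x t) \<otimes> vel M x t) x t - div_ten ?BB x t)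
      + (grad (pressure M) x t + grad (mag_energy M) x t)
    = div_ten (stress M) x t + (rho M x t - tau M x t * ?d) *\<^sub>R force M x t"
    using eqs(2) unfolding momentum_eq_def by (simp add: div_ten_diff grad_add x_diff)
  from arg_cong[OF this, of "\<lambda>a. vel M x t \<bullet> a"]
  have momentum: "vel M x t \<bullet> dt_vec (\<lambda>x t. rho M x t *\<^sub>R vel M x t) x t
      + vel M x t \<bullet> div_ten (\<lambda>x t. (rho M x t *\<^sub>R ?v x t) \<otimes> vel M x t) x t
      - vel M x t \<bullet> div_ten ?BB x t
      + vel M x t \<bullet> grad (pressure M) x t + vel M x t \<bullet> grad (mag_energy M) x t
    = vel M x t \<bullet> div_ten (stress M) x t
      + (rho M x t - tau M x t * ?d) * (vel M x t \<bullet> force M x t)"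
    by (simp add: inner_add_right inner_diff_right)

  \<comment> \<open>With c = u - w_hat the induction terms are exactly the left side of the magnetic
    equation, so they are replaced by its relaxation term \<open>?R\<close>.\<close>
  have "dt (mag_energy M) x t
      + div_vec (\<lambda>x t. (norm (mag M x t))\<^sup>2 *\<^sub>R ?c x t - (?c x t \<bullet> mag M x t) *\<^sub>R mag M x t) x t
    = mag M x t \<bullet> ?R + ?c x t \<bullet> (grad (mag_energy M) x t - div_ten ?BB x t)"
    using magnetic_energy_balance[of "mag M" x t ?c] eqs(4,5)
    by (simp add: magnetic_eq_def x_diff t_differentiable_unknowns mag_energy_def [abs_def])
  then have magnetic: "dt (mag_energy M) x t
      + (div_vec (\<lambda>x t. (norm (mag M x t))\<^sup>2 *\<^sub>R ?c x t) x t
        - div_vec (\<lambda>x t. (?c x t \<bullet> mag M x t) *\<^sub>R mag M x t) x t)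
    = mag M x t \<bullet> ?R + ?c x t \<bullet> (grad (mag_energy M) x t - div_ten ?BB x t)"
    by (simp add: div_vec_diff x_diff)

  have dt_split: "dt (\<lambda>x t. tot_energy M x t + mag_energy M x t) x t
    = dt ?k x t + dt ?e x t + dt (mag_energy M) x t"
    unfolding tot_energy_def mag_energy_def [abs_def]
    by (simp add: dt_add t_differentiable_add t_differentiable_mult t_differentiable_const
        t_differentiable_norm_sq t_differentiable_unknowns del: times_divide_eq_left)
  \<comment> \<open>The energy flux is cut into kinetic, internal and pressure parts; the last
    yields p div(u - w), which stays in the balance, and (u - w) . grad p.\<close>
  have "(\<lambda>x t. (tot_energy M x t + pressure M x t) *\<^sub>R ?v x t)
    = (\<lambda>x t. ?k x t *\<^sub>R ?v x t + ?e x t *\<^sub>R ?v x t + pressure M x t *\<^sub>R ?v x t)"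
    by (simp add: tot_energy_def scaleR_add_left)
  then have div_split: "div_vec (\<lambda>x t. (tot_energy M x t + pressure M x t) *\<^sub>R ?v x t) x t
    = div_vec (\<lambda>x t. ?k x t *\<^sub>R ?v x t) x t + div_vec (\<lambda>x t. ?e x t *\<^sub>R ?v x t) x t
      + (pressure M x t * div_vec ?v x t + ?v x t \<bullet> grad (pressure M) x t)"
    by (simp only: div_vec_add div_vec_scaleR[of "pressure M"] x_diff)
  have tot: "x_differentiable (tot_energy M) x t"
    unfolding tot_energy_def [abs_def] by (intro x_diff)
  \<comment> \<open>The stress power div(Pi u) is split here: u . div Pi will cancel against the
    momentum equation, and Pi : grad u survives.\<close>
  have energy: "dt (\<lambda>x t. tot_energy M x t + mag_energy M x t) x t
      + (div_vec (\<lambda>x t. (tot_energy M x t + pressure M x t) *\<^sub>R ?v x t) x t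
         + div_vec (\<lambda>x t. (norm (mag M x t))\<^sup>2 *\<^sub>R ?c x t) x t
         - div_vec (\<lambda>x t. (?c x t \<bullet> mag M x t) *\<^sub>R mag M x t) x t)
    = div_vec (neg_q M) x t
      + div_vec (\<lambda>x t. (tau M x t * (beta M x t \<bullet> mag M x t)) *\<^sub>R vel M x t) x t
      + (vel M x t \<bullet> div_ten (stress M) x t + stress M x t \<Colon>\<Colon> grad_vec (vel M) x t)
      + rho M x t * (?v x t \<bullet> force M x t) + heat M x t"
    using eqs(3) unfolding energy_eq_def
    by (simp only: div_vec_add div_vec_diff div_vec_matrix_vector_mult x_diff tot)

  have relaxation: "div_vec (\<lambda>x t. (tau M x t * (beta M x t \<bullet> mag M x t)) *\<^sub>R vel M x t) x t
      - mag M x t \<bullet> ?R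
    = div_vec (\<lambda>x t. (tau M x t * (vel M x t \<bullet> mag M x t)) *\<^sub>R beta M x t) x t
      + tau M x t * (advect (vel M) (mag M) x t \<bullet> beta M x t
                     - advect (beta M) (mag M) x t \<bullet> vel M x t)"
    by (intro relaxation_work_balance x_diff)
  have heat_flux: "div_vec (\<lambda>x t. neg_q M x t + (tau M x t * (vel M x t \<bullet> mag M x t)) *\<^sub>R beta M x t) x t
    = div_vec (neg_q M) x t
      + div_vec (\<lambda>x t. (tau M x t * (vel M x t \<bullet> mag M x t)) *\<^sub>R beta M x t) x t"
    by (intro div_vec_add x_diff)
  \<comment> \<open>This accounts for the factor rho - tau div(rho u) of F in the momentum equation:
    rho (u - w) . F - (rho - tau div(rho u)) u . F = -rho w_hat . F.\<close>
  have work: "rho M x t * (w_reg M x t \<bullet> force M x t)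
    = rho M x t * (w_hat M x t \<bullet> force M x t) + tau M x t * ?d * (vel M x t \<bullet> force M x t)"
    unfolding w_reg_eq using nonzero(1) by (simp add: inner_add_left algebra_simps)

  \<comment> \<open>What remains is linear in the listed terms. From (u - w) . grad p - u . grad p
    comes w . grad p on the right; the u part of the Lorentz work at u - w_hat cancels against the
    momentum equation, and its w_hat part joins -rho F . w_hat.\<close>
  show ?thesis
    using kinetic momentum magnetic energy relaxation work
    unfolding dt_split div_split heat_flux inner_diff_left inner_diff_right inner_add_left
      inner_minus_left inner_scaleR_left right_diff_distrib left_diff_distrib
    by (simp add: inner_commute)
qed

end

end

theorem proposition2:
  fixes \<Omega> :: "(real^'n::finite) set" and T :: real and M :: "'n mgd"
  assumes "open \<Omega>" and "connected \<Omega>" and "\<Omega> \<noteq> {}" and "0 < T"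
    and "mgd_data_ok \<Omega> T M"
    and "mgd_smooth \<Omega> T M"
    and "mgd_solution \<Omega> T M"
  shows "\<forall>x\<in>\<Omega>. \<forall>t\<in>{0<..<T}.
    dt (\<lambda>x t. rho M x t * int_energy M x t) x t
    + div_vec (\<lambda>x t. (rho M x t * int_energy M x t) *\<^sub>R (vel M x t - w_reg M x t)) x t
    + pressure M x t * div_vec (\<lambda>x t. vel M x t - w_reg M x t) x t
    = div_vec (\<lambda>x t. neg_q M x t + (tau M x t * (vel M x t \<bullet> mag M x t)) *\<^sub>R beta M x t) x t
      + stress M x t \<Colon>\<Colon> grad_vec (vel M) x t
      + w_reg M x t \<bullet> grad (pressure M) x t
      + (- div_ten (\<lambda>x t. mag M x t \<otimes> mag M x t) x t + grad (mag_energy M) x t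
         - rho M x t *\<^sub>R force M x t) \<bullet> w_hat M x t
      + tau M x t * (advect (vel M) (mag M) x t \<bullet> beta M x t
                     - advect (beta M) (mag M) x t \<bullet> vel M x t)
      + heat M x t"
proof (intro ballI)
  interpret regularized_mgd \<Omega> T M
    using assms(1,5-7) by unfold_locales
  fix x t assume "x \<in> \<Omega>" "t \<in> {0<..<T}"
  then show "dt (\<lambda>x t. rho M x t * int_energy M x t) x t
    + div_vec (\<lambda>x t. (rho M x t * int_energy M x t) *\<^sub>R (vel M x t - w_reg M x t)) x t
    + pressure M x t * div_vec (\<lambda>x t. vel M x t - w_reg M x t) x t
    = div_vec (\<lambda>x t. neg_q M x t + (tau M x t * (vel M x t \<bullet> mag M x t)) *\<^sub>R beta M x t) x t
      + stress M x t \<Colon>\<Colon> grad_vec (vel M) x t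
      + w_reg M x t \<bullet> grad (pressure M) x t
      + (- div_ten (\<lambda>x t. mag M x t \<otimes> mag M x t) x t + grad (mag_energy M) x t
         - rho M x t *\<^sub>R force M x t) \<bullet> w_hat M x t
      + tau M x t * (advect (vel M) (mag M) x t \<bullet> beta M x t
                     - advect (beta M) (mag M) x t \<bullet> vel M x t)
      + heat M x t"
    by (rule internal_energy_balance)
qed

end
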